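(* Let $a<b$ be real numbers, let $\omega_5\in\mathbb{C}$ satisfy $\omega_5^5=1$ and $\omega_5\neq 1$, and set $\gamma_5=\frac{\omega_5}{\omega_5-1}$. The quadrature rule $$ \begin{aligned} \int_a^b f(x) \, dx \approx \; & \frac{b-a}{2} \bigl(f(b) + f(a)\bigr) - \frac{(b-a)^2\, \Re(\gamma_5^2)}{2!} \bigl( f'(b) - f'(a) \bigr) \\ & + \frac{(b-a)^3\, \Re(\gamma_5^3)}{3!} \bigl( f''(b) + f''(a) \bigr) - \frac{(b-a)^4\, \Re(\gamma_5^4)}{4!} \bigl( f'''(b) - f'''(a) \bigr) \end{aligned} $$ is exact (i.e. equality holds) for all real polynomials $f$ of degree at most $4$.
   Context: $\Re(z)$ denotes the real part of a complex number $z$. *)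

theory Defs
  imports "HOL-Analysis.Analysis" "HOL-Computational_Algebra.Polynomial"
begin

definition quadrature_weight_param :: "complex \<Rightarrow> complex" where
  "quadrature_weight_param \<omega> = \<omega> / (\<omega> - 1)"

definition quadrature5 :: "complex \<Rightarrow> real \<Rightarrow> real \<Rightarrow> (real \<Rightarrow> real) \<Rightarrow> real" where
  "quadrature5 \<gamma> a b f =
     (b - a) / 2 * (f b + f a)
     - (b - a) ^ 2 * Re (\<gamma> ^ 2) / fact 2 * (deriv f b - deriv f a)
     + (b - a) ^ 3 * Re (\<gamma> ^ 3) / fact 3 * ((deriv ^^ 2) f b + (deriv ^^ 2) f a)
     - (b - a) ^ 4 * Re (\<gamma> ^ 4) / fact 4 * ((deriv ^^ 3) f b - (deriv ^^ 3) f a)"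

end

theory Submission
  imports Defs
begin

text \<open>
  The rule comes from repeated integration by parts. Put \<open>h = b - a\<close> and consider the
  normalised powers \<open>Q k x = Re ((x - b + h * \<gamma>) ^ k) / k!\<close>, each of which is an antiderivative
  of its predecessor, with \<open>Q 0 = 1\<close>. If \<open>f\<close> is a polynomial of degree at most \<open>4\<close>, then
  the alternating sum of the \<open>Q (k + 1)\<close> times the \<open>k\<close>-th derivative of \<open>f\<close>, for
  \<open>k < 5\<close>, is an antiderivative of \<open>f\<close> (\<open>alternating_sum_has_derivative\<close>), because the
  fifth derivative of \<open>f\<close> vanishes.

  The special choice of \<open>\<gamma> = \<omega> / (\<omega> - 1)\<close> governs the boundary values. Since \<open>\<omega>\<close> has
  modulus \<open>1\<close>, the real part of \<open>\<gamma>\<close> is \<open>1 / 2\<close>, that is \<open>\<gamma> - 1 = - cnj \<gamma>\<close>; hence the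
  values of \<open>Q k\<close> at the two end points agree up to the sign \<open>(-1) ^ k\<close>, which gives the
  alternating symmetric and antisymmetric combinations in the rule. Since moreover
  \<open>\<omega> ^ 5 = 1\<close>, it follows that \<open>\<gamma> ^ 5 = (\<gamma> - 1) ^ 5 = - cnj (\<gamma> ^ 5)\<close>, so \<open>Re (\<gamma> ^ 5) = 0\<close>: the term
  with the fourth derivative disappears at both end points, and so the rule stops at
  the third derivative.
\<close>

lemma higher_deriv_poly:
  fixes p :: "real poly"
  shows "(deriv ^^ k) (poly p) = poly ((pderiv ^^ k) p)"
proof (induction k)
  case (Suc k)
  show ?case
    unfolding funpow.simps o_apply Suc.IH
    by (rule ext) (rule DERIV_imp_deriv, rule poly_DERIV)
qed simp

lemma higher_pderiv_eq_0:
  fixes p :: "real poly"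
  assumes "degree p < k"
  shows "(pderiv ^^ k) p = 0"
proof (rule poly_eqI)
  fix n
  show "coeff ((pderiv ^^ k) p) n = coeff 0 n"
    using assms by (simp add: coeff_higher_pderiv coeff_eq_0)
qed

text \<open>
  Integration by parts, iterated: the derivative of each product \<open>Q (k + 1) * f k\<close> has two terms,
  and with alternating signs all but the two outermost ones cancel.
\<close>

lemma alternating_sum_has_derivative:
  fixes f Q :: "nat \<Rightarrow> real \<Rightarrow> real"
  assumes f: "\<And>k. (f k has_real_derivative f (Suc k) x) (at x)"
    and Q: "\<And>k. (Q (Suc k) has_real_derivative Q k x) (at x)"
  shows "((\<lambda>x. \<Sum>k<n. (-1) ^ k * (Q (Suc k) x * f k x)) has_real_derivative
           Q 0 x * f 0 x - (-1) ^ n * (Q n x * f n x)) (at x)"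
proof (induction n)
  case (Suc n)
  show ?case
    unfolding sum.lessThan_Suc
    by (rule DERIV_cong[OF DERIV_add[OF Suc.IH DERIV_cmult[OF DERIV_mult[OF Q f]]]])
       (simp add: algebra_simps)
qed simp

lemma Re_power_div_fact_has_derivative:
  "((\<lambda>x. Re ((of_real x + c) ^ Suc k) / fact (Suc k)) has_real_derivative
     Re ((of_real x + c) ^ k) / fact k) (at x)"
proof -
  have "((\<lambda>z. (z + c) ^ Suc k) has_field_derivative of_nat (Suc k) * (of_real x + c) ^ k)
          (at (of_real x))"
    by (rule derivative_eq_intros refl | simp)+
  then have "((\<lambda>x. (of_real x + c) ^ Suc k) has_vector_derivative
               of_nat (Suc k) * (of_real x + c) ^ k) (at x)"
    using has_vector_derivative_real_field by blast
  then have "((\<lambda>x. Re ((of_real x + c) ^ Suc k)) has_real_derivative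
               Re (of_nat (Suc k) * (of_real x + c) ^ k)) (at x)"
    by (rule has_vector_derivative_complex_iff[THEN iffD1, THEN conjunct1])
  then have "((\<lambda>x. Re ((of_real x + c) ^ Suc k) / fact (Suc k)) has_real_derivative
               Re (of_nat (Suc k) * (of_real x + c) ^ k) / fact (Suc k)) (at x)"
    by (rule DERIV_cdivide)
  moreover have "Re (of_nat (Suc k) * z) / fact (Suc k) = Re z / fact k" for z
  proof -
    have "Re (of_nat (Suc k) * z) = real (Suc k) * Re z"
      by (simp del: of_nat_Suc)
    then show ?thesis
      by (simp del: of_nat_Suc)
  qed
  ultimately show ?thesis by simp
qed

text \<open>
  The fractional linear map \<open>\<omega> \<mapsto> \<omega> / (\<omega> - 1)\<close> sends the unit circle (minus \<open>1\<close>) to the line \<open>Re z = 1 / 2\<close>, whose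
  points are those with \<open>z - 1 = - cnj z\<close>.
\<close>

lemma weight_param_minus_1:
  assumes "norm \<omega> = 1" and "\<omega> \<noteq> 1"
  shows "quadrature_weight_param \<omega> - 1 = - cnj (quadrature_weight_param \<omega>)"
proof -
  have "\<omega> * cnj \<omega> = 1"
    using assms(1) by (simp add: complex_norm_square[symmetric])
  moreover have "cnj \<omega> \<noteq> 1"
    using assms(2) by (metis complex_cnj_cnj complex_cnj_one)
  ultimately show ?thesis
    using assms(2) by (simp add: quadrature_weight_param_def field_simps)
qed

lemma Re_weight_param_power_eq_0:
  assumes "odd n" and "\<omega> ^ n = 1" and "\<omega> \<noteq> 1"
  shows "Re (quadrature_weight_param \<omega> ^ n) = 0"
proof -
  let ?\<gamma> = "quadrature_weight_param \<omega>"
  have "norm \<omega> = 1"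
    using assms(1,2) by (auto dest: power_eq_1_iff)
  have "?\<gamma> = \<omega> * (?\<gamma> - 1)"
    using assms(3) by (simp add: quadrature_weight_param_def field_simps)
  then have "?\<gamma> ^ n = (\<omega> * (?\<gamma> - 1)) ^ n"
    by (rule arg_cong)
  also have "\<dots> = (?\<gamma> - 1) ^ n"
    using assms(2) by (simp add: power_mult_distrib)
  also have "\<dots> = - cnj (?\<gamma> ^ n)"
    using weight_param_minus_1[OF \<open>norm \<omega> = 1\<close> assms(3)] assms(1) by simp
  finally have "Re (?\<gamma> ^ n) = Re (- cnj (?\<gamma> ^ n))" by (rule arg_cong)
  then show ?thesis by (simp del: complex_cnj_power)
qed

theorem mainTheorem9:
  fixes a b :: real and \<omega> :: complex and p :: "real poly"
  assumes "a < b"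
    and "\<omega> ^ 5 = 1" and "\<omega> \<noteq> 1"
    and "degree p \<le> 4"
  shows "integral {a..b} (poly p) = quadrature5 (quadrature_weight_param \<omega>) a b (poly p)"
proof -
  define \<gamma> where "\<gamma> = quadrature_weight_param \<omega>"
  \<comment> \<open>The shift is chosen so that \<open>x + c\<close> is \<open>(b - a) * \<gamma>\<close> at \<open>b\<close> and \<open>(b - a) * (\<gamma> - 1)\<close> at \<open>a\<close>.\<close>
  define c where "c = of_real (b - a) * \<gamma> - of_real b"
  define Q where "Q = (\<lambda>k x. Re ((of_real x + c) ^ k) / fact k)"
  define f where "f = (\<lambda>k. poly ((pderiv ^^ k) p))"
  define F where "F = (\<lambda>x. \<Sum>k<5. (-1) ^ k * (Q (Suc k) x * f k x))"

  have "norm \<omega> = 1"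
    using assms(2) by (auto dest: power_eq_1_iff)
  then have \<gamma>: "\<gamma> - 1 = - cnj \<gamma>"
    unfolding \<gamma>_def using assms(3) by (rule weight_param_minus_1)
  have Re1: "Re \<gamma> = 1 / 2"
    using arg_cong[OF \<gamma>, of Re] by simp
  have Re5: "Re (\<gamma> ^ 5) = 0"
    unfolding \<gamma>_def using assms(2,3) by (intro Re_weight_param_power_eq_0) auto

  have Qb: "Q k b = (b - a) ^ k * Re (\<gamma> ^ k) / fact k" for k
  proof -
    have "(of_real b + c) ^ k = of_real ((b - a) ^ k) * \<gamma> ^ k"
      by (simp add: c_def power_mult_distrib)
    then show ?thesis by (simp add: Q_def del: of_real_power)
  qed
  have Qa: "Q k a = (-1) ^ k * Q k b" for k
  proof -
    have "of_real a + c = of_real (b - a) * (\<gamma> - 1)"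
      by (simp add: c_def algebra_simps)
    also have "\<dots> = of_real (- (b - a)) * cnj \<gamma>"
      by (simp add: \<gamma> algebra_simps)
    finally have "(of_real a + c) ^ k = of_real ((- (b - a)) ^ k) * cnj (\<gamma> ^ k)"
      by (simp add: power_mult_distrib)
    then have "Q k a = (- (b - a)) ^ k * Re (\<gamma> ^ k) / fact k"
      by (simp add: Q_def del: of_real_power complex_cnj_power)
    then show ?thesis
      using Qb power_minus[of "b - a" k] by simp
  qed

  have "(F has_real_derivative poly p x) (at x)" for x
  proof -
    have "(f k has_real_derivative f (Suc k) x) (at x)" for k
      by (simp add: f_def)
    moreover have "(Q (Suc k) has_real_derivative Q k x) (at x)" for k
      unfolding Q_def by (rule Re_power_div_fact_has_derivative)
    ultimately have "(F has_real_derivative Q 0 x * f 0 x - (-1) ^ 5 * (Q 5 x * f 5 x)) (at x)"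
      unfolding F_def by (rule alternating_sum_has_derivative)
    moreover have "f 5 x = 0"
      unfolding f_def using assms(4) by (subst higher_pderiv_eq_0) auto
    ultimately show ?thesis by (simp add: Q_def f_def)
  qed
  then have "(poly p has_integral F b - F a) {a..b}"
    using assms(1)
    by (intro fundamental_theorem_of_calculus)
       (auto simp: has_real_derivative_iff_has_vector_derivative
             intro: has_vector_derivative_at_within)
  then have "integral {a..b} (poly p) = F b - F a"
    by (rule integral_unique)
  also have "\<dots> = (\<Sum>k<5. (-1) ^ k * Q (Suc k) b * (f k b + (-1) ^ k * f k a))"
    unfolding F_def Qa sum_subtractf[symmetric] by (intro sum.cong) (auto simp: algebra_simps)
  also have "\<dots> = quadrature5 \<gamma> a b (poly p)"
  proof -
    have "deriv (poly p) = f 1" "(deriv ^^ 2) (poly p) = f 2" "(deriv ^^ 3) (poly p) = f 3"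
      using higher_deriv_poly[of 1 p] higher_deriv_poly[of 2 p] higher_deriv_poly[of 3 p]
      by (simp_all add: f_def)
    moreover have "f 0 = poly p" by (simp add: f_def)
    moreover have "(\<Sum>k<5. (-1) ^ k * Q (Suc k) b * (f k b + (-1) ^ k * f k a)) =
        Q 1 b * (f 0 b + f 0 a) - Q 2 b * (f 1 b - f 1 a) + Q 3 b * (f 2 b + f 2 a)
        - Q 4 b * (f 3 b - f 3 a) + Q 5 b * (f 4 b + f 4 a)"
      by (simp add: eval_nat_numeral)
    ultimately show ?thesis
      by (simp add: quadrature5_def Qb Re1 Re5)
  qed
  finally show ?thesis by (simp add: \<gamma>_def)
qed

end
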